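(* Let $G$ be a graph with vertices $x_1,\ldots,x_n$, let $I=J(G)\subseteq R=\mathbb{K}[x_1,\dots,x_n]$ be its cover ideal, and let $F=x_1\cdots x_n$. Assume that $\operatorname{sdefect}(I,2)=1$ and that $G$ satisfies the Indecomposability Property. Let $\nu(I,m)$ be the number of minimal monomial generators of $I^m$ which are not divisible by $F$. Then for $m\geq 3$, $$\operatorname{sdefect}(I,m)=\operatorname{sdefect}(I,m-2)+\nu(I,m-2).$$
   Context: $\mathbb{K}$ is a field. For a finite simple graph $G$ with vertex set $\{x_1,\dots,x_n\}$ and edge set $E$, the cover ideal is $J(G)=\bigcap_{\{x_i,x_j\}\in E}(x_i,x_j)\subseteq R=\mathbb{K}[x_1,\dots,x_n]$; its $m$-th symbolic power is $J(G)^{(m)}=\bigcap_{\{x_i,x_j\}\in E}(x_i,x_j)^m$. For an ideal $I$, $\operatorname{sdefect}(I,m)=\mu(I^{(m)}/I^m)$, the minimal number of generators of the $R$-module $I^{(m)}/I^m$. Indecomposability Property: let $I=J(G)=(g_1,\ldots,g_t)$, where $g_1,\dots,g_t$ are the minimal monomial generators, assume $\operatorname{sdefect}(I,2)=1$, and let $F=x_1\cdots x_n$. The graph $G$ satisfies the Indecomposability Property if for all integers $k\geq 1$ and $s\geq 0$ and all (not necessarily distinct) indices $i_1,\dots,i_s\in\{1,\dots,t\}$, the monomial $F^k g_{i_1}\cdots g_{i_s}$ does not belong to $I^{2k+s}$.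
   Formalization: The graph is assumed to have no isolated vertices; without this the formula fails, e.g. for a triangle plus an isolated vertex at m = 4, where sdefect(I,4) = 4 but sdefect(I,2) + ν(I,2) = 1 + 6 = 7. *)

theory Defs
  imports "HOL-Library.Poly_Mapping" "HOL-Library.Set_Algebras" "HOL-Library.Extended_Nat"
begin

section \<open>Polynomials, ideals and their powers\<close>

text \<open>
  The ring \<open>R\<close> is the type of polynomials over \<open>'k\<close> whose variables are the elements of the
  finite type \<open>'v\<close>; the number \<open>n\<close> of variables is \<open>CARD('v)\<close>.
\<close>

type_synonym ('v, 'k) mpoly = "('v \<Rightarrow>\<^sub>0 nat) \<Rightarrow>\<^sub>0 'k"

definition monom :: "('v \<Rightarrow>\<^sub>0 nat) \<Rightarrow> ('v, 'k::field) mpoly" where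
  "monom e = Poly_Mapping.single e 1"

definition var :: "'v \<Rightarrow> ('v, 'k::field) mpoly" where
  "var v = monom (Poly_Mapping.single v 1)"

definition prod_vars :: "('v::finite, 'k::field) mpoly" where
  "prod_vars = (\<Prod>v\<in>UNIV. var v)"

text \<open>Ideals of a commutative ring are its submodules as a module over itself.\<close>

lemma module_times: "module ((*) :: 'a::comm_ring_1 \<Rightarrow> 'a \<Rightarrow> 'a)"
  by standard (auto simp: algebra_simps)

abbreviation is_ideal :: "'a::comm_ring_1 set \<Rightarrow> bool" where
  "is_ideal \<equiv> module.subspace (*)"

abbreviation ideal_gen :: "'a::comm_ring_1 set \<Rightarrow> 'a set" where
  "ideal_gen \<equiv> module.span (*)"

definition ideal_mult :: "'a::comm_ring_1 set \<Rightarrow> 'a set \<Rightarrow> 'a set" where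
  "ideal_mult I J = ideal_gen {a * b | a b. a \<in> I \<and> b \<in> J}"

primrec ideal_pow :: "'a::comm_ring_1 set \<Rightarrow> nat \<Rightarrow> 'a set" where
  "ideal_pow I 0 = UNIV"
| "ideal_pow I (Suc m) = ideal_mult I (ideal_pow I m)"

section \<open>Number of generators of a quotient module\<close>

text \<open>
  For ideals \<open>N \<subseteq> M\<close> the elements of \<open>M/N\<close> are the cosets \<open>a +o N\<close> with \<open>a \<in> M\<close>. Cosets are
  added as sets, and \<open>r\<close> times the coset \<open>X\<close> is the coset \<open>r *o X + N\<close>; the summand \<open>N\<close> is
  needed because \<open>r *o X\<close> alone is in general only part of a coset.
\<close>

definition quotient_carrier :: "'a::comm_ring_1 set \<Rightarrow> 'a set \<Rightarrow> 'a set set" where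
  "quotient_carrier M N = (\<lambda>a. a +o N) ` M"

definition coset_scale :: "'a::comm_ring_1 set \<Rightarrow> 'a \<Rightarrow> 'a set \<Rightarrow> 'a set" where
  "coset_scale N r X = r *o X + N"

lemma coset_add:
  assumes "is_ideal N"
  shows "(a +o N) + (b +o N) = (a + b) +o N"
proof -
  interpret module "(*) :: 'a \<Rightarrow> 'a \<Rightarrow> 'a" by (rule module_times)
  have "N + N = N"
    using assms subspace_add[OF assms] subspace_0[OF assms]
    by (force simp: set_plus_def)
  then show ?thesis
    by (simp add: set_plus_rearrange)
qed

lemma coset_scale_coset:
  assumes "is_ideal N"
  shows "coset_scale N r (a +o N) = (r * a) +o N"
proof -
  interpret module "(*) :: 'a \<Rightarrow> 'a \<Rightarrow> 'a" by (rule module_times)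
  have "\<exists>b\<in>N. r * (a + x) + y = r * a + b" if "x \<in> N" "y \<in> N" for x y
    using that subspace_add[OF assms] subspace_scale[OF assms]
    by (intro bexI[of _ "r * x + y"]) (auto simp: distrib_left add.assoc)
  moreover have "\<exists>x\<in>N. \<exists>y\<in>N. r * a + b = r * (a + x) + y" if "b \<in> N" for b
    using that subspace_0[OF assms] by (intro bexI[of _ 0] bexI[of _ b]) auto
  ultimately show ?thesis
    unfolding coset_scale_def set_plus_def elt_set_plus_def elt_set_times_def by blast
qed

definition quotient_submodule :: "'a::comm_ring_1 set \<Rightarrow> 'a set \<Rightarrow> 'a set set \<Rightarrow> bool" where
  "quotient_submodule M N U \<longleftrightarrow>
     U \<subseteq> quotient_carrier M N \<and> N \<in> U \<and>
     (\<forall>X\<in>U. \<forall>Y\<in>U. X + Y \<in> U) \<and> (\<forall>r. \<forall>X\<in>U. coset_scale N r X \<in> U)"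

definition generates_quotient :: "'a::comm_ring_1 set \<Rightarrow> 'a set \<Rightarrow> 'a set set \<Rightarrow> bool" where
  "generates_quotient M N A \<longleftrightarrow>
     A \<subseteq> quotient_carrier M N \<and>
     (\<forall>U. quotient_submodule M N U \<and> A \<subseteq> U \<longrightarrow> U = quotient_carrier M N)"

text \<open>The value is \<open>\<infinity>\<close> if \<open>M/N\<close> is not finitely generated.\<close>

definition num_gens_quotient :: "'a::comm_ring_1 set \<Rightarrow> 'a set \<Rightarrow> enat" where
  "num_gens_quotient M N = Inf {enat (card A) | A. finite A \<and> generates_quotient M N A}"

section \<open>Minimal monomial generators\<close>

definition is_min_monom_gens :: "('v, 'k::field) mpoly set \<Rightarrow> ('v, 'k) mpoly set \<Rightarrow> bool" where
  "is_min_monom_gens B J \<longleftrightarrow>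
     B \<subseteq> range monom \<and> ideal_gen B = J \<and> (\<forall>B'. B' \<subset> B \<longrightarrow> ideal_gen B' \<noteq> J)"

definition min_monom_gens :: "('v, 'k::field) mpoly set \<Rightarrow> ('v, 'k) mpoly set" where
  "min_monom_gens J = (THE B. is_min_monom_gens B J)"

lemma monom_in_ideal_gen_dvd:
  assumes "B \<subseteq> range monom" and "(monom e :: ('v, 'k::field) mpoly) \<in> ideal_gen B"
  shows "\<exists>b\<in>B. b dvd monom e"
proof -
  interpret module "(*) :: ('v, 'k) mpoly \<Rightarrow> _ \<Rightarrow> _" by (rule module_times)
  obtain T r where T: "finite T" "T \<subseteq> B" and e: "monom e = (\<Sum>a\<in>T. r a * a)"
    using assms(2) unfolding span_explicit by blast
  have "(\<Sum>a\<in>T. Poly_Mapping.lookup (r a * a) e) = Poly_Mapping.lookup (monom e :: ('v, 'k) mpoly) e"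
    unfolding e by (simp add: lookup_sum)
  also have "\<dots> \<noteq> 0"
    by (simp add: monom_def)
  finally obtain a where a: "a \<in> T" "Poly_Mapping.lookup (r a * a) e \<noteq> 0"
    by (meson sum.neutral)
  obtain d where d: "a = monom d"
    using a(1) T(2) assms(1) by blast
  have "e \<in> Poly_Mapping.keys (r a * a)"
    using a(2) by (simp add: in_keys_iff)
  then obtain c where "e = c + d"
    using keys_mult[of "r a" a] unfolding d monom_def by auto
  then have "monom e = monom c * a"
    unfolding d monom_def by (simp add: mult_single)
  then show ?thesis
    using a(1) T(2) by (metis dvd_triv_right subsetD)
qed

lemma monom_dvd_antisym:
  assumes "(monom d :: ('v, 'k::field) mpoly) dvd monom e" and "monom e dvd (monom d :: ('v, 'k) mpoly)"
  shows "(monom d :: ('v, 'k) mpoly) = monom e"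
proof -
  have *: "\<exists>c. b = c + a" if ab: "(monom a :: ('v, 'k) mpoly) dvd monom b" for a b
  proof -
    obtain q where q: "(monom b :: ('v, 'k) mpoly) = monom a * q"
      using ab by (rule dvdE)
    have "b \<in> Poly_Mapping.keys (monom a * q)"
      unfolding q[symmetric] by (simp add: monom_def)
    then show ?thesis
      using keys_mult[of "monom a" q] by (auto simp: monom_def add.commute)
  qed
  obtain c c' where "e = c + d" "d = c' + e"
    using *[OF assms(1)] *[OF assms(2)] by blast
  then have "d = e"
    by (intro poly_mapping_eqI) (metis add_leD2 le_antisym lookup_add order_refl)
  then show ?thesis by simp
qed

lemma is_min_monom_gens_unique:
  assumes "is_min_monom_gens B J" and "is_min_monom_gens B' J"
  shows "B \<subseteq> B'"
proof
  interpret module "(*) :: ('a, 'b) mpoly \<Rightarrow> _ \<Rightarrow> _" by (rule module_times)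
  fix b assume b: "b \<in> B"
  have monoms: "B \<subseteq> range monom" "B' \<subseteq> range monom" and gen: "ideal_gen B = J" "ideal_gen B' = J"
    using assms by (auto simp: is_min_monom_gens_def)
  obtain e where e: "b = monom e" using b monoms(1) by auto
  have "monom e \<in> ideal_gen B'"
    using b gen span_base[of b B] unfolding e by simp
  from monom_in_ideal_gen_dvd[OF monoms(2) this]
  obtain b' where b': "b' \<in> B'" "b' dvd b" unfolding e by (elim bexE)
  obtain e' where e': "b' = monom e'" using b'(1) monoms(2) by auto
  have "monom e' \<in> ideal_gen B"
    using b'(1) gen span_base[of b' B'] unfolding e' by simp
  from monom_in_ideal_gen_dvd[OF monoms(1) this]
  obtain c where c: "c \<in> B" "c dvd b'" unfolding e' by (elim bexE)
  have "c = b"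
  proof (rule ccontr)
    assume "c \<noteq> b"
    then have "c \<in> ideal_gen (B - {b})" using c(1) by (simp add: span_base)
    moreover obtain q where "b = c * q"
      using dvd_trans[OF c(2) b'(2)] by (rule dvdE)
    ultimately have "b \<in> ideal_gen (B - {b})" by (metis span_scale mult.commute)
    then have "x \<in> ideal_gen (B - {b})" if "x \<in> B" for x
      using that span_base[of x "B - {b}"] by (cases "x = b") simp_all
    then have "ideal_gen B \<subseteq> ideal_gen (B - {b})"
      by (intro span_minimal subspace_span subsetI)
    then have "ideal_gen (B - {b}) = J"
      using gen(1) span_mono[of "B - {b}" B] by auto
    moreover have "B - {b} \<subset> B" using b by auto
    ultimately show False using assms(1) unfolding is_min_monom_gens_def by simp
  qed
  then have "b' = b"
    using monom_dvd_antisym[of e' e] b'(2) c(2) unfolding e e' by simp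
  then show "b \<in> B'" using b'(1) by simp
qed

lemma min_monom_gens_eq: "is_min_monom_gens B J \<Longrightarrow> min_monom_gens J = B"
  unfolding min_monom_gens_def
  by (rule the_equality) (auto dest: is_min_monom_gens_unique)

definition nu :: "('v::finite, 'k::field) mpoly set \<Rightarrow> nat \<Rightarrow> nat" where
  "nu I m = card {g \<in> min_monom_gens (ideal_pow I m). \<not> prod_vars dvd g}"

section \<open>Cover ideals of finite simple graphs\<close>

text \<open>A finite simple graph with vertex set \<open>UNIV :: 'v set\<close> is given by its set of edges.\<close>

definition simple_graph :: "'v::finite set set \<Rightarrow> bool" where
  "simple_graph E \<longleftrightarrow> (\<forall>e\<in>E. card e = 2)"

text \<open>
  The usual convention for cover ideals. It matters here because \<open>prod_vars\<close> is the product of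
  all vertices: for a triangle \<open>a, b, c\<close> with an additional isolated vertex, \<open>I\<^sup>(\<^sup>2\<^sup>)/I\<^sup>2\<close> is
  generated by \<open>abc\<close> rather than by the product of all four vertices.
\<close>

definition no_isolated_vertices :: "'v::finite set set \<Rightarrow> bool" where
  "no_isolated_vertices E \<longleftrightarrow> (\<forall>v. \<exists>e\<in>E. v \<in> e)"

definition cover_ideal :: "'v::finite set set \<Rightarrow> ('v, 'k::field) mpoly set" where
  "cover_ideal E = (\<Inter>e\<in>E. ideal_gen (var ` e))"

definition cover_symbolic_power :: "'v::finite set set \<Rightarrow> nat \<Rightarrow> ('v, 'k::field) mpoly set" where
  "cover_symbolic_power E m = (\<Inter>e\<in>E. ideal_pow (ideal_gen (var ` e)) m)"

text \<open>
  The symbolic defect of the cover ideal. The coefficient field is passed as a type argument,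
  since it occurs neither in the graph nor in the result type.
\<close>

definition sdefect :: "'k::field itself \<Rightarrow> 'v::finite set set \<Rightarrow> nat \<Rightarrow> enat" where
  "sdefect _ E m =
     num_gens_quotient (cover_symbolic_power E m) (ideal_pow (cover_ideal E :: ('v, 'k) mpoly set) m)"

text \<open>
  The property is only considered for graphs whose cover ideal has second symbolic defect 1;
  this standing assumption is not part of the definition.
\<close>

definition indecomposability_property :: "'k::field itself \<Rightarrow> 'v::finite set set \<Rightarrow> bool" where
  "indecomposability_property _ E \<longleftrightarrow>
     (\<forall>k \<ge> 1. \<forall>gs. set gs \<subseteq> min_monom_gens (cover_ideal E :: ('v, 'k) mpoly set) \<longrightarrow>
        prod_vars ^ k * prod_list gs \<notin> ideal_pow (cover_ideal E) (2 * k + length gs))"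

end

theory Submission
  imports Defs "HOL-Library.FuncSet"
begin

text \<open>
  All ideals in question are spanned by monomials, so they are sets of exponent vectors closed
  under adding vectors. The monomials of \<open>I\<^sup>(\<^sup>m\<^sup>)\<close> are the \<open>m\<close>-covers of the graph: vectors whose
  two entries on each edge add up to at least \<open>m\<close>. The monomials of \<open>I\<^sup>m\<close> are the sums of
  \<open>m\<close> 1-covers; the all-ones vector is the exponent of \<open>F\<close>.

  For monomial ideals \<open>N \<subseteq> M\<close> the module \<open>M/N\<close> needs exactly as many generators as \<open>M\<close> has
  minimal monomials outside \<open>N\<close> (\<open>num_gens_quotient_monomial_ideals\<close>); this is Nakayama's lemma,
  and comes down to a comparison of dimensions over the field. So the symbolic defect counts the
  minimal \<open>m\<close>-covers that are not sums of \<open>m\<close> 1-covers.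

  Every \<open>m\<close>-cover with \<open>m \<ge> 2\<close> is the sum of a 2-cover and an \<open>(m-2)\<close>-cover
  (\<open>covers_split\<close>). If the second symbolic defect is 1, then \<open>F\<close> is the only new generator of
  \<open>I\<^sup>(\<^sup>2\<^sup>)\<close>, and the splitting gives \<open>I\<^sup>(\<^sup>m\<^sup>) = I\<^sup>m + F I\<^sup>(\<^sup>m\<^sup>-\<^sup>2\<^sup>)\<close>. Indecomposability says that no minimal
  generator of \<open>I\<^sup>(\<^sup>m\<^sup>-\<^sup>2\<^sup>)\<close> enters \<open>I\<^sup>m\<close> when multiplied by \<open>F\<close>. Hence multiplication by \<open>F\<close> is
  a bijection from the minimal generators of \<open>I\<^sup>(\<^sup>m\<^sup>-\<^sup>2\<^sup>)\<close> to those of \<open>I\<^sup>(\<^sup>m\<^sup>)\<close> outside \<open>I\<^sup>m\<close>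
  (\<open>minimal_covers_not_sums\<close>). Among the former, those outside \<open>I\<^sup>m\<^sup>-\<^sup>2\<close> are counted by the
  symbolic defect at \<open>m - 2\<close>, and those inside are the minimal generators of \<open>I\<^sup>m\<^sup>-\<^sup>2\<close> that
  \<open>F\<close> does not divide (\<open>minimal_covers_in_sums\<close>).
\<close>

abbreviation lookup :: "('a \<Rightarrow>\<^sub>0 'b::zero) \<Rightarrow> 'a \<Rightarrow> 'b" where
  "lookup \<equiv> Poly_Mapping.lookup"

abbreviation keys :: "('a \<Rightarrow>\<^sub>0 'b::zero) \<Rightarrow> 'a set" where
  "keys \<equiv> Poly_Mapping.keys"

abbreviation single :: "'a \<Rightarrow> 'b::zero \<Rightarrow> 'a \<Rightarrow>\<^sub>0 'b" where
  "single \<equiv> Poly_Mapping.single"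

section \<open>Exponent vectors under divisibility\<close>

definition exp_dvd :: "('v \<Rightarrow>\<^sub>0 nat) \<Rightarrow> ('v \<Rightarrow>\<^sub>0 nat) \<Rightarrow> bool" (infix "\<preceq>" 50) where
  "d \<preceq> e \<longleftrightarrow> (\<forall>v. lookup d v \<le> lookup e v)"

definition up_closed :: "('v \<Rightarrow>\<^sub>0 nat) set \<Rightarrow> bool" where
  "up_closed U \<longleftrightarrow> (\<forall>d\<in>U. \<forall>e. d \<preceq> e \<longrightarrow> e \<in> U)"

definition minimals :: "('v \<Rightarrow>\<^sub>0 nat) set \<Rightarrow> ('v \<Rightarrow>\<^sub>0 nat) set" where
  "minimals U = {u \<in> U. \<forall>w\<in>U. w \<preceq> u \<longrightarrow> w = u}"

lemma exp_dvd_refl [simp]: "d \<preceq> d"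
  by (simp add: exp_dvd_def)

lemma exp_dvd_trans: "d \<preceq> e \<Longrightarrow> e \<preceq> f \<Longrightarrow> d \<preceq> f"
  unfolding exp_dvd_def by (meson order_trans)

lemma exp_dvd_add_right [simp]: "d \<preceq> d + c" and exp_dvd_add_left [simp]: "d \<preceq> c + d"
  by (simp_all add: exp_dvd_def lookup_add)

lemma exp_dvd_add_cancel [simp]: "c + d \<preceq> c + e \<longleftrightarrow> d \<preceq> e"
  by (simp add: exp_dvd_def lookup_add)

lemma exp_dvd_add_mono: "d \<preceq> e \<Longrightarrow> d' \<preceq> e' \<Longrightarrow> d + d' \<preceq> e + e'"
  by (simp add: exp_dvd_def lookup_add add_mono)

lemma exp_dvd_imp_diff_add: "d \<preceq> e \<Longrightarrow> d + (e - d) = e"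
  by (intro poly_mapping_eqI) (simp add: exp_dvd_def lookup_add lookup_minus)

lemma exp_dvd_iff_ex_add: "d \<preceq> e \<longleftrightarrow> (\<exists>c. e = c + d)"
  by (metis exp_dvd_add_left exp_dvd_imp_diff_add add.commute)

lemma up_closedD: "up_closed U \<Longrightarrow> d \<in> U \<Longrightarrow> d \<preceq> e \<Longrightarrow> e \<in> U"
  by (auto simp: up_closed_def)

lemma minimals_subset: "minimals U \<subseteq> U"
  by (auto simp: minimals_def)

lemma minimalsD: "u \<in> minimals U \<Longrightarrow> w \<in> U \<Longrightarrow> w \<preceq> u \<Longrightarrow> w = u"
  by (auto simp: minimals_def)

text \<open>
  A proper divisor has a smaller total degree, so descent terminates.
\<close>

lemma ex_minimal_exp_dvd:
  assumes "u \<in> U"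
  shows "\<exists>w\<in>minimals U. w \<preceq> u"
  using assms
proof (induction "\<Sum>v\<in>keys u. lookup u v" arbitrary: u rule: less_induct)
  case less
  show ?case
  proof (cases "u \<in> minimals U")
    case True
    then show ?thesis using exp_dvd_refl by blast
  next
    case False
    then obtain w where w: "w \<in> U" "w \<preceq> u" "w \<noteq> u"
      using less.prems by (auto simp: minimals_def)
    have sub: "keys w \<subseteq> keys u"
    proof
      fix v assume "v \<in> keys w"
      then have "lookup w v > 0" by (simp add: in_keys_iff)
      then have "lookup u v > 0" using w(2) unfolding exp_dvd_def by (meson less_le_trans)
      then show "v \<in> keys u" by (simp add: in_keys_iff)
    qed
    obtain v where v: "lookup w v \<noteq> lookup u v"
      using w(3) by (auto simp: poly_mapping_eq_iff fun_eq_iff)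
    then have lt: "lookup w v < lookup u v"
      using w(2) unfolding exp_dvd_def by (meson le_neq_implies_less)
    then have "v \<in> keys u" by (simp add: in_keys_iff)
    have "(\<Sum>v\<in>keys w. lookup w v) = (\<Sum>v\<in>keys u. lookup w v)"
      using sub by (intro sum.mono_neutral_left) (auto simp: in_keys_iff)
    also have "\<dots> < (\<Sum>v\<in>keys u. lookup u v)"
      using w(2) lt \<open>v \<in> keys u\<close> by (intro sum_strict_mono_ex1) (auto simp: exp_dvd_def)
    finally show ?thesis
      using less.hyps[of w] w exp_dvd_trans by blast
  qed
qed

section \<open>Monomial ideals as sets of exponent vectors\<close>

definition monomial_ideal :: "('v \<Rightarrow>\<^sub>0 nat) set \<Rightarrow> ('v, 'k::field) mpoly set" where
  "monomial_ideal U = {p. keys p \<subseteq> U}"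

lemma keys_monom [simp]: "keys (monom e :: ('v, 'k::field) mpoly) = {e}"
  by (simp add: monom_def)

lemma monom_eq_iff [simp]: "(monom d :: ('v, 'k::field) mpoly) = monom e \<longleftrightarrow> d = e"
  by (metis keys_monom singleton_inject)

lemma monom_mult: "(monom d :: ('v, 'k::field) mpoly) * monom e = monom (d + e)"
  by (simp add: monom_def mult_single)

lemma single_mult_monom: "single d c * (monom e :: ('v, 'k::field) mpoly) = single (d + e) c"
  by (simp add: monom_def mult_single)

lemma monom_in_monomial_ideal [simp]:
  "(monom e :: ('v, 'k::field) mpoly) \<in> monomial_ideal U \<longleftrightarrow> e \<in> U"
  by (simp add: monomial_ideal_def)

lemma monom_dvd_iff: "(monom d :: ('v, 'k::field) mpoly) dvd monom e \<longleftrightarrow> d \<preceq> e"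
proof
  assume "(monom d :: ('v, 'k) mpoly) dvd monom e"
  then obtain q where q: "(monom e :: ('v, 'k) mpoly) = monom d * q" by (rule dvdE)
  have "e \<in> keys (monom d * q)"
    unfolding q[symmetric] by simp
  then show "d \<preceq> e"
    using keys_mult[of "monom d" q] by auto
next
  assume "d \<preceq> e"
  then show "(monom d :: ('v, 'k) mpoly) dvd monom e"
    by (metis exp_dvd_imp_diff_add monom_mult dvd_triv_left)
qed

lemma poly_as_sum_of_terms: "p = (\<Sum>e\<in>keys p. single e (lookup p e))"
proof (rule poly_mapping_eqI)
  fix d
  have "(\<Sum>e\<in>keys p. lookup (single e (lookup p e)) d) = (\<Sum>e\<in>keys p. if e = d then lookup p e else 0)"
    by (intro sum.cong) (auto simp: lookup_single when_def)
  also have "\<dots> = lookup p d"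
    by (simp add: in_keys_iff)
  finally show "lookup p d = lookup (\<Sum>e\<in>keys p. single e (lookup p e)) d"
    by (simp add: lookup_sum)
qed

lemma is_ideal_monomial_ideal:
  assumes "up_closed U"
  shows "is_ideal (monomial_ideal U :: ('v, 'k::field) mpoly set)"
proof -
  interpret module "(*) :: ('v, 'k) mpoly \<Rightarrow> _ \<Rightarrow> _" by (rule module_times)
  show ?thesis
  proof (rule subspaceI)
    show "0 \<in> (monomial_ideal U :: ('v, 'k) mpoly set)"
      by (simp add: monomial_ideal_def)
  next
    fix p q :: "('v, 'k) mpoly"
    assume "p \<in> monomial_ideal U" "q \<in> monomial_ideal U"
    then show "p + q \<in> monomial_ideal U"
      using keys_add[of p q] by (auto simp: monomial_ideal_def)
  next
    fix r p :: "('v, 'k) mpoly"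
    assume "p \<in> monomial_ideal U"
    then show "r * p \<in> monomial_ideal U"
      using keys_mult[of r p] up_closedD[OF assms _ exp_dvd_add_left]
      by (fastforce simp: monomial_ideal_def)
  qed
qed

lemma monomial_ideal_subset:
  fixes J :: "('v, 'k::field) mpoly set"
  assumes J: "is_ideal J" and U: "\<And>u. u \<in> U \<Longrightarrow> monom u \<in> J"
  shows "monomial_ideal U \<subseteq> J"
proof
  interpret module "(*) :: ('v, 'k) mpoly \<Rightarrow> _ \<Rightarrow> _" by (rule module_times)
  fix p :: "('v, 'k) mpoly" assume p: "p \<in> monomial_ideal U"
  have "single e (lookup p e) \<in> J" if "e \<in> keys p" for e
  proof -
    have "single e (lookup p e) = single 0 (lookup p e) * monom e"
      by (simp add: single_mult_monom)
    moreover have "monom e \<in> J"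
      using U p that by (auto simp: monomial_ideal_def)
    ultimately show ?thesis
      using subspace_scale[OF J] by metis
  qed
  then have "(\<Sum>e\<in>keys p. single e (lookup p e)) \<in> J"
    by (rule subspace_sum[OF J])
  then show "p \<in> J"
    using poly_as_sum_of_terms[of p] by simp
qed

lemma ideal_gen_monoms:
  "ideal_gen (monom ` S :: ('v, 'k::field) mpoly set) = monomial_ideal {e. \<exists>s\<in>S. s \<preceq> e}"
proof
  interpret module "(*) :: ('v, 'k) mpoly \<Rightarrow> _ \<Rightarrow> _" by (rule module_times)
  have "up_closed {e. \<exists>s\<in>S. s \<preceq> e}"
    unfolding up_closed_def using exp_dvd_trans by blast
  then have "is_ideal (monomial_ideal {e. \<exists>s\<in>S. s \<preceq> e} :: ('v, 'k) mpoly set)"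
    by (rule is_ideal_monomial_ideal)
  moreover have "(monom ` S :: ('v, 'k) mpoly set) \<subseteq> monomial_ideal {e. \<exists>s\<in>S. s \<preceq> e}"
    by (auto intro!: bexI exp_dvd_refl)
  ultimately show "ideal_gen (monom ` S :: ('v, 'k) mpoly set) \<subseteq> monomial_ideal {e. \<exists>s\<in>S. s \<preceq> e}"
    by (intro span_minimal)
  show "monomial_ideal {e. \<exists>s\<in>S. s \<preceq> e} \<subseteq> ideal_gen (monom ` S :: ('v, 'k) mpoly set)"
  proof (rule monomial_ideal_subset[OF subspace_span])
    fix u assume "u \<in> {e. \<exists>s\<in>S. s \<preceq> e}"
    then obtain s c where "s \<in> S" "u = c + s"
      by (auto simp: exp_dvd_iff_ex_add)
    then have "monom u = monom c * (monom s :: ('v, 'k) mpoly)"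
      by (simp add: monom_mult)
    then show "monom u \<in> ideal_gen (monom ` S :: ('v, 'k) mpoly set)"
      using \<open>s \<in> S\<close> by (simp add: span_base span_scale)
  qed
qed

lemma up_closed_set_plus:
  assumes "up_closed U"
  shows "up_closed (U + V)"
  unfolding up_closed_def
proof (intro ballI allI impI)
  fix d e assume "d \<in> U + V" "d \<preceq> e"
  then obtain u v c where "u \<in> U" "v \<in> V" "e = (c + u) + v"
    by (auto simp: exp_dvd_iff_ex_add add.assoc elim!: set_plus_elim)
  moreover have "c + u \<in> U"
    using up_closedD[OF assms \<open>u \<in> U\<close>] by simp
  ultimately show "e \<in> U + V" by blast
qed

lemma ideal_mult_monomial_ideal:
  assumes "up_closed U"
  shows "ideal_mult (monomial_ideal U) (monomial_ideal V :: ('v, 'k::field) mpoly set) =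
    monomial_ideal (U + V)"
proof
  interpret module "(*) :: ('v, 'k) mpoly \<Rightarrow> _ \<Rightarrow> _" by (rule module_times)
  have "p * q \<in> monomial_ideal (U + V)"
    if "p \<in> monomial_ideal U" "q \<in> monomial_ideal V" for p q :: "('v, 'k) mpoly"
  proof -
    have "keys p \<subseteq> U" "keys q \<subseteq> V"
      using that by (auto simp: monomial_ideal_def)
    then have "keys (p * q) \<subseteq> U + V"
      using keys_mult[of p q] set_plus_intro[of _ U _ V] by fastforce
    then show ?thesis by (simp add: monomial_ideal_def)
  qed
  then show "ideal_mult (monomial_ideal U) (monomial_ideal V :: ('v, 'k) mpoly set) \<subseteq> monomial_ideal (U + V)"
    unfolding ideal_mult_def
    by (intro span_minimal is_ideal_monomial_ideal up_closed_set_plus assms) auto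
  show "monomial_ideal (U + V) \<subseteq> ideal_mult (monomial_ideal U) (monomial_ideal V :: ('v, 'k) mpoly set)"
    unfolding ideal_mult_def
  proof (rule monomial_ideal_subset[OF subspace_span])
    fix w assume "w \<in> U + V"
    then obtain u v where "u \<in> U" "v \<in> V" "w = u + v" by (rule set_plus_elim)
    moreover from this have "monom w = monom u * (monom v :: ('v, 'k) mpoly)"
      by (simp add: monom_mult)
    ultimately show "monom w \<in> ideal_gen {a * b |a b. a \<in> monomial_ideal U \<and>
        b \<in> (monomial_ideal V :: ('v, 'k) mpoly set)}"
      using monom_in_monomial_ideal by (intro span_base) blast
  qed
qed

text \<open>
  The empty sum is everything and not just \<open>0\<close>, as the zeroth power of an ideal is the whole ring.
\<close>

primrec fold_sum :: "'a::monoid_add set \<Rightarrow> nat \<Rightarrow> 'a set" where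
  "fold_sum U 0 = UNIV"
| "fold_sum U (Suc m) = U + fold_sum U m"

lemma up_closed_fold_sum: "up_closed U \<Longrightarrow> up_closed (fold_sum U m)"
  by (cases m) (auto simp: up_closed_set_plus, simp add: up_closed_def)

lemma ideal_pow_monomial_ideal:
  assumes "up_closed U"
  shows "ideal_pow (monomial_ideal U :: ('v, 'k::field) mpoly set) m = monomial_ideal (fold_sum U m)"
proof (induction m)
  case 0
  show ?case by (simp add: monomial_ideal_def)
next
  case (Suc m)
  then show ?case by (simp add: ideal_mult_monomial_ideal assms)
qed

lemma monomial_ideal_minimals:
  assumes "up_closed U"
  shows "ideal_gen (monom ` minimals U) = (monomial_ideal U :: ('v, 'k::field) mpoly set)"
proof -
  have "{e. \<exists>s\<in>minimals U. s \<preceq> e} = U"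
    by (auto intro: ex_minimal_exp_dvd up_closedD[OF assms] subsetD[OF minimals_subset])
  then show ?thesis by (simp add: ideal_gen_monoms)
qed

lemma min_monom_gens_monomial_ideal:
  assumes "up_closed U"
  shows "min_monom_gens (monomial_ideal U :: ('v, 'k::field) mpoly set) = monom ` minimals U"
proof (rule min_monom_gens_eq)
  have "ideal_gen B' \<noteq> (monomial_ideal U :: ('v, 'k) mpoly set)" if B': "B' \<subset> monom ` minimals U" for B'
  proof
    assume eq: "ideal_gen B' = (monomial_ideal U :: ('v, 'k) mpoly set)"
    obtain u where u: "u \<in> minimals U" "(monom u :: ('v, 'k) mpoly) \<notin> B'"
      using B' by (auto dest!: psubset_imp_ex_mem)
    have "(monom u :: ('v, 'k) mpoly) \<in> ideal_gen B'"
      unfolding eq using u(1) minimals_subset by auto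
    moreover have "B' \<subseteq> range monom" using B' by auto
    ultimately obtain b where b: "b \<in> B'" "b dvd monom u"
      using monom_in_ideal_gen_dvd[of B' u] by metis
    obtain w where w: "w \<in> minimals U" "b = monom w"
      using b(1) B' by auto
    then have "w \<in> U" "w \<preceq> u"
      using b(2) minimals_subset by (auto simp: monom_dvd_iff)
    then have "w = u"
      by (rule minimalsD[OF u(1)])
    then show False using b(1) w(2) u(2) by simp
  qed
  then show "is_min_monom_gens (monom ` minimals U) (monomial_ideal U :: ('v, 'k) mpoly set)"
    unfolding is_min_monom_gens_def using monomial_ideal_minimals[OF assms] by (intro conjI allI impI) (simp_all add: image_mono)
qed

section \<open>Generators of a quotient of monomial ideals\<close>

text \<open>
  Let \<open>S\<close> be a finite set of minimal elements of \<open>U\<close> outside \<open>V\<close>. Reading off the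
  coefficients at \<open>S\<close> kills the ideal of \<open>V\<close>, and on the ideal of \<open>U\<close> it turns multiplication
  by a polynomial \<open>r\<close> into multiplication by the constant term of \<open>r\<close>: a product of a monomial
  of \<open>r\<close> with an element of \<open>U\<close> can only be minimal if the former is trivial.
\<close>

definition coeff_part :: "('v \<Rightarrow>\<^sub>0 nat) set \<Rightarrow> ('v, 'k::field) mpoly \<Rightarrow> ('v, 'k) mpoly" where
  "coeff_part S p = (\<Sum>s\<in>S. single s (lookup p s))"

lemma lookup_coeff_part:
  "finite S \<Longrightarrow> lookup (coeff_part S p) e = (lookup p e when e \<in> S)"
  by (simp add: coeff_part_def lookup_sum lookup_single when_def)

lemma coeff_part_add: "coeff_part S (p + q) = coeff_part S p + coeff_part S q"
  by (simp add: coeff_part_def lookup_add single_add sum.distrib)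

text \<open>
  In the convolution formula for the coefficient at \<open>s\<close>, a pair with a nontrivial first exponent
  would exhibit a proper divisor of \<open>s\<close> in \<open>U\<close>.
\<close>

lemma lookup_mult_minimal:
  assumes p: "p \<in> monomial_ideal U" and s: "s \<in> minimals U"
  shows "lookup (r * p :: ('v, 'k::field) mpoly) s = lookup r 0 * lookup p s"
proof -
  have "lookup (r * p) s = (\<Sum>d\<in>keys r. \<Sum>e\<in>keys p. lookup (single d (lookup r d) * single e (lookup p e)) s)"
    by (subst poly_as_sum_of_terms[of r], subst poly_as_sum_of_terms[of p])
      (simp add: sum_product lookup_sum)
  also have "\<dots> = (\<Sum>d\<in>keys r. \<Sum>e\<in>keys p. if d = 0 \<and> e = s then lookup r d * lookup p e else 0)"
  proof (intro sum.cong refl)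
    fix d e assume "e \<in> keys p"
    then have "e \<in> U" using p by (auto simp: monomial_ideal_def)
    then have "d + e = s \<longleftrightarrow> d = 0 \<and> e = s"
      using minimalsD[OF s, of e] by (metis add_0 add_right_imp_eq exp_dvd_add_left)
    then show "lookup (single d (lookup r d) * single e (lookup p e)) s =
        (if d = 0 \<and> e = s then lookup r d * lookup p e else 0)"
      by (simp add: mult_single lookup_single when_def)
  qed
  also have "\<dots> = (\<Sum>d\<in>keys r. if d = 0 then \<Sum>e\<in>keys p. if e = s then lookup r d * lookup p e else 0 else 0)"
    by (intro sum.cong) auto
  also have "\<dots> = lookup r 0 * lookup p s"
    by (auto simp: in_keys_iff)
  finally show ?thesis .
qed

lemma coeff_part_mult:
  assumes "p \<in> monomial_ideal U" and "S \<subseteq> minimals U"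
  shows "coeff_part S (r * p :: ('v, 'k::field) mpoly) = single 0 (lookup r 0) * coeff_part S p"
  unfolding coeff_part_def sum_distrib_left mult_single
  using assms by (intro sum.cong) (auto simp: lookup_mult_minimal)

lemma vector_space_mpoly: "vector_space (\<lambda>(c::'k::field) (p::('v, 'k) mpoly). single 0 c * p)"
  by standard (auto simp: algebra_simps single_add mult_single simp flip: mult.assoc)

lemma independent_monoms:
  assumes "finite S"
  shows "\<not> module.dependent (\<lambda>(c::'k::field) p. single 0 c * p) (monom ` S :: ('v, 'k) mpoly set)"
proof -
  interpret vector_space "\<lambda>(c::'k) (p::('v, 'k) mpoly). single 0 c * p"
    by (rule vector_space_mpoly)
  show ?thesis
  proof (rule independent_if_scalars_zero)
    show "finite (monom ` S :: ('v, 'k) mpoly set)" using assms by simp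
  next
    fix f :: "('v, 'k) mpoly \<Rightarrow> 'k" and x :: "('v, 'k) mpoly"
    assume 0: "(\<Sum>x\<in>monom ` S. single 0 (f x) * x) = 0" and "x \<in> monom ` S"
    then obtain s where s: "s \<in> S" "x = monom s" by blast
    have "(\<Sum>x\<in>monom ` S. single 0 (f x) * x) = (\<Sum>t\<in>S. single t (f (monom t)))"
      by (subst sum.reindex) (auto simp: inj_on_def single_mult_monom)
    then have "(\<Sum>t\<in>S. lookup (single t (f (monom t))) s) = 0"
      using 0 by (metis lookup_sum lookup_zero)
    then show "f x = 0"
      using s assms by (simp add: lookup_single when_def)
  qed
qed

lemma elt_set_plus_eqD:
  fixes N :: "'a::comm_ring_1 set"
  assumes "is_ideal N" and "a +o N = b +o N"
  shows "a - b \<in> N"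
proof -
  interpret module "(*) :: 'a \<Rightarrow> 'a \<Rightarrow> 'a" by (rule module_times)
  have "a \<in> a +o N"
    using subspace_0[OF assms(1)] set_plus_intro2[of 0 N a] by simp
  then show ?thesis
    unfolding assms(2) by (rule set_plus_imp_minus)
qed

text \<open>
  The preimage in the polynomial ring of a submodule of the quotient is an ideal. Minimal
  elements in \<open>V\<close> give the zero coset, so this ideal contains all minimal monomials of \<open>U\<close>.
\<close>

lemma generates_quotient_minimals:
  fixes U V :: "('v \<Rightarrow>\<^sub>0 nat) set"
  defines "M \<equiv> monomial_ideal U :: ('v, 'k::field) mpoly set" and "N \<equiv> monomial_ideal V"
  assumes U: "up_closed U" and V: "up_closed V"
  shows "generates_quotient M N ((\<lambda>s. monom s +o N) ` (minimals U - V))"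
  unfolding generates_quotient_def
proof (intro conjI allI impI)
  interpret module "(*) :: ('v, 'k) mpoly \<Rightarrow> _ \<Rightarrow> _" by (rule module_times)
  have ideals: "is_ideal M" "is_ideal N"
    using U V by (auto simp: M_def N_def is_ideal_monomial_ideal)
  show "(\<lambda>s. monom s +o N) ` (minimals U - V) \<subseteq> quotient_carrier M N"
    using minimals_subset by (fastforce simp: quotient_carrier_def M_def)
  fix W assume "quotient_submodule M N W \<and> (\<lambda>s. monom s +o N) ` (minimals U - V) \<subseteq> W"
  then have W: "W \<subseteq> quotient_carrier M N" "N \<in> W" "\<And>X Y. X \<in> W \<Longrightarrow> Y \<in> W \<Longrightarrow> X + Y \<in> W"
    "\<And>r X. X \<in> W \<Longrightarrow> coset_scale N r X \<in> W" "\<And>s. s \<in> minimals U - V \<Longrightarrow> monom s +o N \<in> W"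
    by (auto simp: quotient_submodule_def)
  define J where "J = {a. a +o N \<in> W}"
  have "is_ideal J"
  proof (rule subspaceI)
    show "0 \<in> J" using W(2) by (simp add: J_def)
  next
    fix a b assume "a \<in> J" "b \<in> J"
    then show "a + b \<in> J"
      using W(3) coset_add[OF ideals(2)] by (metis J_def mem_Collect_eq)
  next
    fix r a assume "a \<in> J"
    then show "r * a \<in> J"
      using W(4) coset_scale_coset[OF ideals(2)] by (metis J_def mem_Collect_eq)
  qed
  moreover have "monom s \<in> J" if s: "s \<in> minimals U" for s
  proof (cases "s \<in> V")
    case True
    then have "monom s \<in> N" by (simp add: N_def)
    then have "monom s +o N = N"
      using subspace_add[OF ideals(2)] subspace_diff[OF ideals(2)]
      by (metis (no_types, lifting) add.commute diff_add_cancel elt_set_plus_def set_minus_imp_plus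
          set_plus_imp_minus subsetI subset_antisym set_plus_intro2)
    then show ?thesis using W(2) by (simp add: J_def)
  next
    case False
    then show ?thesis using W(5) s by (simp add: J_def)
  qed
  ultimately have "M \<subseteq> J"
    unfolding M_def monomial_ideal_minimals[OF U, symmetric]
    by (intro span_minimal image_subsetI)
  then show "W = quotient_carrier M N"
    using W(1) by (auto simp: quotient_carrier_def J_def)
qed

text \<open>
  Reading off the coefficients at \<open>S = minimals U - V\<close> maps any generating family of the quotient to a family
  that spans the vector space on the monomials of \<open>S\<close>, because the cosets whose representatives
  have their coefficients in that span form a submodule. Hence no generating family, monomial or
  not, has fewer than \<open>card S\<close> members.
\<close>

lemma card_minimals_le_generators:
  fixes U V :: "('v \<Rightarrow>\<^sub>0 nat) set"
  defines "M \<equiv> monomial_ideal U :: ('v, 'k::field) mpoly set" and "N \<equiv> monomial_ideal V"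
  assumes U: "up_closed U" and V: "up_closed V"
    and S: "finite (minimals U - V)"
    and A: "finite A" "generates_quotient M N A"
  shows "card (minimals U - V) \<le> card A"
proof -
  define S where "S = minimals U - V"
  have finS: "finite S" using S by (simp add: S_def)
  interpret R: module "(*) :: ('v, 'k) mpoly \<Rightarrow> _ \<Rightarrow> _" by (rule module_times)
  interpret vector_space "\<lambda>(c::'k) (p::('v, 'k) mpoly). single 0 c * p"
    by (rule vector_space_mpoly)
  have ideals: "is_ideal M" "is_ideal N"
    using U V by (auto simp: M_def N_def is_ideal_monomial_ideal)
  have A_sub: "A \<subseteq> (\<lambda>a. a +o N) ` M"
    using A(2) by (simp add: generates_quotient_def quotient_carrier_def)
  then have "\<forall>X\<in>A. \<exists>a\<in>M. X = a +o N" by blast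
  then obtain rep where rep: "\<And>X. X \<in> A \<Longrightarrow> rep X \<in> M \<and> X = rep X +o N"
    by metis
  define T where "T = (\<lambda>X. coeff_part S (rep X)) ` A"
  define W where "W = (\<lambda>a. a +o N) ` {a \<in> M. coeff_part S a \<in> span T}"
  have "quotient_submodule M N W"
    unfolding quotient_submodule_def
  proof (intro conjI ballI allI)
    show "W \<subseteq> quotient_carrier M N"
      by (auto simp: W_def quotient_carrier_def)
    have "0 \<in> {a \<in> M. coeff_part S a \<in> span T}"
      using R.subspace_0[OF ideals(1)] by (simp add: coeff_part_def span_zero)
    then show "N \<in> W"
      unfolding W_def by (rule image_eqI[rotated]) simp
  next
    fix X Y assume "X \<in> W" "Y \<in> W"
    then obtain a b where ab: "a \<in> M" "b \<in> M" "coeff_part S a \<in> span T" "coeff_part S b \<in> span T"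
      and XY: "X = a +o N" "Y = b +o N"
      by (auto simp: W_def)
    have "a + b \<in> M" "coeff_part S (a + b) \<in> span T"
      using ab R.subspace_add[OF ideals(1)] by (auto simp: coeff_part_add span_add)
    then show "X + Y \<in> W"
      unfolding XY coset_add[OF ideals(2)] W_def by (intro imageI) simp
  next
    fix r X assume "X \<in> W"
    then obtain a where a: "a \<in> M" "coeff_part S a \<in> span T" and X: "X = a +o N"
      by (auto simp: W_def)
    have "coeff_part S (r * a) = single 0 (lookup r 0) * coeff_part S a"
      using a(1) by (intro coeff_part_mult[where U = U]) (auto simp: M_def S_def)
    then have "r * a \<in> M" "coeff_part S (r * a) \<in> span T"
      using a R.subspace_scale[OF ideals(1)] span_scale[of "coeff_part S a" T "lookup r 0"] by auto
    then show "coset_scale N r X \<in> W"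
      unfolding X coset_scale_coset[OF ideals(2)] W_def by (intro imageI) simp
  qed
  moreover have "A \<subseteq> W"
  proof
    fix X assume X: "X \<in> A"
    then have "coeff_part S (rep X) \<in> span T"
      by (simp add: T_def span_base)
    then show "X \<in> W"
      using rep[OF X] unfolding W_def by (intro image_eqI[where x = "rep X"]) auto
  qed
  ultimately have W: "W = quotient_carrier M N"
    using A(2) by (simp add: generates_quotient_def)
  have "monom s \<in> span T" if s: "s \<in> S" for s
  proof -
    have "monom s \<in> M"
      using s minimals_subset by (auto simp: M_def S_def)
    then have "monom s +o N \<in> W"
      unfolding W quotient_carrier_def by (rule imageI)
    then obtain a where a: "coeff_part S a \<in> span T" "monom s +o N = a +o N"
      by (auto simp: W_def)
    then have "monom s - a \<in> N"
      using elt_set_plus_eqD[OF ideals(2)] by blast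
    then have diff: "lookup (monom s - a) t = 0" if "t \<in> S" for t
      using that by (auto simp: N_def monomial_ideal_def S_def in_keys_iff)
    have "coeff_part S a = coeff_part S (monom s)"
      unfolding coeff_part_def using diff by (intro sum.cong) (auto simp: lookup_minus)
    also have "\<dots> = monom s"
      using s finS by (intro poly_mapping_eqI) (auto simp: lookup_coeff_part monom_def lookup_single when_def)
    finally show ?thesis using a by simp
  qed
  then have "card (monom ` S :: ('v, 'k) mpoly set) \<le> card T"
    using independent_span_bound[of T "monom ` S"] independent_monoms[OF finS] A(1)
    by (auto simp: T_def)
  also have "\<dots> \<le> card A"
    unfolding T_def using A(1) by (rule card_image_le)
  finally show ?thesis
    by (simp add: card_image inj_on_def flip: S_def)
qed

lemma num_gens_quotient_monomial_ideals:
  assumes "up_closed U" "up_closed V" and fin: "finite (minimals U - V)"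
  shows "num_gens_quotient (monomial_ideal U) (monomial_ideal V :: ('v, 'k::field) mpoly set) =
    enat (card (minimals U - V))"
proof (rule antisym)
  let ?M = "monomial_ideal U :: ('v, 'k) mpoly set" and ?N = "monomial_ideal V :: ('v, 'k) mpoly set"
  let ?A = "(\<lambda>s. monom s +o ?N) ` (minimals U - V)"
  have "num_gens_quotient ?M ?N \<le> enat (card ?A)"
    unfolding num_gens_quotient_def
    using generates_quotient_minimals[OF assms(1,2)] fin by (intro Inf_lower) blast
  also have "\<dots> \<le> enat (card (minimals U - V))"
    using fin by (simp add: card_image_le)
  finally show "num_gens_quotient ?M ?N \<le> enat (card (minimals U - V))" .
  show "enat (card (minimals U - V)) \<le> num_gens_quotient ?M ?N"
    unfolding num_gens_quotient_def
    using card_minimals_le_generators[OF assms] by (intro Inf_greatest) auto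
qed

section \<open>Covers of a graph\<close>

definition vec :: "('v::finite \<Rightarrow> nat) \<Rightarrow> ('v \<Rightarrow>\<^sub>0 nat)" where
  "vec f = (\<Sum>v\<in>UNIV. single v (f v))"

abbreviation ones :: "'v::finite \<Rightarrow>\<^sub>0 nat" where
  "ones \<equiv> vec (\<lambda>_. 1)"

definition covers :: "'v::finite set set \<Rightarrow> nat \<Rightarrow> ('v \<Rightarrow>\<^sub>0 nat) set" where
  "covers E m = {d. \<forall>e\<in>E. m \<le> (\<Sum>v\<in>e. lookup d v)}"

lemma lookup_vec [simp]: "lookup (vec f) v = f v"
  by (simp add: vec_def lookup_sum lookup_single when_def)

lemma vec_add: "vec f + vec g = vec (\<lambda>v. f v + g v)"
  by (rule poly_mapping_eqI) (simp add: lookup_add)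

lemma vec_0: "vec (\<lambda>_. 0) = 0"
  by (rule poly_mapping_eqI) simp

lemma up_closed_sum_ge: "up_closed {d. (m::nat) \<le> (\<Sum>v\<in>e. lookup d v)}"
  unfolding up_closed_def exp_dvd_def by (auto elim!: order_trans intro!: sum_mono)

lemma up_closed_covers: "up_closed (covers E m)"
  unfolding up_closed_def covers_def exp_dvd_def
  by (auto elim!: order_trans intro!: sum_mono dest!: bspec)

lemma covers_add: "a \<in> covers E m \<Longrightarrow> b \<in> covers E n \<Longrightarrow> a + b \<in> covers E (m + n)"
  by (auto simp: covers_def lookup_add sum.distrib intro: add_mono)

text \<open>
  The \<open>m\<close>-th power of the ideal generated by the variables in \<open>e\<close> is spanned by the monomials
  of degree at least \<open>m\<close> in these variables, since one variable at a time can be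
  split off from such a monomial.
\<close>

lemma fold_sum_sum_ge:
  fixes e :: "'v::finite set"
  shows "fold_sum {d :: 'v \<Rightarrow>\<^sub>0 nat. 1 \<le> (\<Sum>v\<in>e. lookup d v)} m = {d. m \<le> (\<Sum>v\<in>e. lookup d v)}"
proof (induction m)
  case 0
  show ?case by simp
next
  case (Suc m)
  let ?U = "{d :: 'v \<Rightarrow>\<^sub>0 nat. 1 \<le> (\<Sum>v\<in>e. lookup d v)}"
  show ?case
  proof
    show "fold_sum ?U (Suc m) \<subseteq> {d. Suc m \<le> (\<Sum>v\<in>e. lookup d v)}"
    proof
      fix d assume "d \<in> fold_sum ?U (Suc m)"
      then obtain a b where "1 \<le> (\<Sum>v\<in>e. lookup a v)" "m \<le> (\<Sum>v\<in>e. lookup b v)" "d = a + b"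
        using Suc by (auto elim!: set_plus_elim)
      then show "d \<in> {d. Suc m \<le> (\<Sum>v\<in>e. lookup d v)}"
        by (simp add: lookup_add sum.distrib)
    qed
    show "{d. Suc m \<le> (\<Sum>v\<in>e. lookup d v)} \<subseteq> fold_sum ?U (Suc m)"
    proof
      fix d assume "d \<in> {d. Suc m \<le> (\<Sum>v\<in>e. lookup d v)}"
      then have d: "Suc m \<le> (\<Sum>v\<in>e. lookup d v)" by simp
      then have "(\<Sum>v\<in>e. lookup d v) \<noteq> 0" by linarith
      then obtain v where v: "v \<in> e" "lookup d v \<noteq> 0"
        by (meson sum.neutral)
      then have "single v 1 \<preceq> d"
        by (simp add: exp_dvd_def lookup_single when_def)
      then have eq: "d = single v 1 + (d - single v 1)"
        by (simp add: exp_dvd_imp_diff_add)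
      have one: "(\<Sum>w\<in>e. lookup (single v 1) w) = (1::nat)"
        using v(1) by (simp add: lookup_single when_def)
      have "(\<Sum>w\<in>e. lookup d w) = (\<Sum>w\<in>e. lookup (single v 1) w + lookup (d - single v 1) w)"
        using eq lookup_add by metis
      also have "\<dots> = 1 + (\<Sum>w\<in>e. lookup (d - single v 1) w)"
        unfolding sum.distrib one ..
      finally have "(\<Sum>w\<in>e. lookup d w) = 1 + (\<Sum>w\<in>e. lookup (d - single v 1) w)" .
      then have "m \<le> (\<Sum>w\<in>e. lookup (d - single v 1) w)"
        using d by linarith
      then have "single v 1 + (d - single v 1) \<in> fold_sum ?U (Suc m)"
        using one Suc by (simp add: set_plus_intro)
      then show "d \<in> fold_sum ?U (Suc m)"
        using eq by simp
    qed
  qed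
qed

lemma ideal_gen_vars:
  "ideal_gen (var ` e :: ('v::finite, 'k::field) mpoly set) =
    monomial_ideal {d. 1 \<le> (\<Sum>v\<in>e. lookup d v)}"
proof -
  have "(\<exists>v\<in>e. single v 1 \<preceq> d) \<longleftrightarrow> 1 \<le> (\<Sum>v\<in>e. lookup d v)" for d :: "'v \<Rightarrow>\<^sub>0 nat"
  proof -
    have "single v 1 \<preceq> d \<longleftrightarrow> lookup d v \<noteq> 0" for v
      by (auto simp: exp_dvd_def lookup_single when_def dest: spec[of _ v])
    moreover have "1 \<le> (\<Sum>v\<in>e. lookup d v) \<longleftrightarrow> (\<Sum>v\<in>e. lookup d v) \<noteq> 0"
      by linarith
    ultimately show ?thesis by simp
  qed
  then show ?thesis
    using ideal_gen_monoms[of "(\<lambda>v. single v 1) ` e"] by (simp add: var_def image_image)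
qed

lemma cover_symbolic_power_eq:
  "(cover_symbolic_power E m :: ('v::finite, 'k::field) mpoly set) = monomial_ideal (covers E m)"
proof -
  have "ideal_pow (ideal_gen (var ` e)) m =
      (monomial_ideal {d. m \<le> (\<Sum>v\<in>e. lookup d v)} :: ('v, 'k) mpoly set)" for e :: "'v set"
    unfolding ideal_gen_vars ideal_pow_monomial_ideal[OF up_closed_sum_ge] fold_sum_sum_ge ..
  then show ?thesis
    by (auto simp: cover_symbolic_power_def monomial_ideal_def covers_def)
qed

lemma cover_ideal_eq:
  "(cover_ideal E :: ('v::finite, 'k::field) mpoly set) = monomial_ideal (covers E 1)"
  by (auto simp: cover_ideal_def ideal_gen_vars monomial_ideal_def covers_def)

abbreviation cover_sums :: "'v::finite set set \<Rightarrow> nat \<Rightarrow> ('v \<Rightarrow>\<^sub>0 nat) set" where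
  "cover_sums E \<equiv> fold_sum (covers E 1)"

lemma ideal_pow_cover_ideal_eq:
  "ideal_pow (cover_ideal E :: ('v::finite, 'k::field) mpoly set) m = monomial_ideal (cover_sums E m)"
  by (simp add: cover_ideal_eq ideal_pow_monomial_ideal up_closed_covers)

lemma prod_vars_eq: "(prod_vars :: ('v::finite, 'k::field) mpoly) = monom ones"
proof -
  have "(\<Prod>v\<in>A. var v) = (monom (\<Sum>v\<in>A. single v 1) :: ('v, 'k) mpoly)" if "finite A" for A
    using that by induction (simp_all add: var_def monom_mult, simp add: monom_def)
  then show ?thesis by (simp add: prod_vars_def vec_def)
qed

lemma monom_power: "(monom ones :: ('v::finite, 'k::field) mpoly) ^ k = monom (vec (\<lambda>_. k))"
  by (induction k) (simp add: vec_0 monom_def, simp add: monom_mult vec_add)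

lemma prod_list_monom: "prod_list (map monom ds) = (monom (sum_list ds) :: ('v, 'k::field) mpoly)"
  by (induction ds) (simp add: monom_def, simp add: monom_mult)

text \<open>
  Cutting all entries of an \<open>m\<close>-cover down to \<open>m\<close> leaves an \<open>m\<close>-cover, so a minimal one has
  entries at most \<open>m\<close>.
\<close>

lemma finite_minimals_covers: "finite (minimals (covers E m))"
proof -
  have "minimals (covers E m) \<subseteq> vec ` (UNIV \<rightarrow>\<^sub>E {..m})"
  proof
    fix d assume d: "d \<in> minimals (covers E m)"
    define t where "t = vec (\<lambda>v. min (lookup d v) m)"
    have "m \<le> (\<Sum>v\<in>e. lookup t v)" if e: "e \<in> E" for e
    proof (cases "\<exists>v\<in>e. m \<le> lookup d v")
      case True
      then obtain v where "v \<in> e" "lookup t v = m"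
        by (auto simp: t_def)
      then show ?thesis
        using member_le_sum[of v e "lookup t"] by simp
    next
      case False
      then have "(\<Sum>v\<in>e. lookup t v) = (\<Sum>v\<in>e. lookup d v)"
        by (intro sum.cong) (auto simp: t_def)
      then show ?thesis
        using d e minimals_subset[of "covers E m"] by (auto simp: covers_def)
    qed
    then have "t \<in> covers E m" by (simp add: covers_def)
    moreover have "t \<preceq> d" by (simp add: t_def exp_dvd_def)
    ultimately have "t = d" by (rule minimalsD[OF d])
    then have "d = vec (\<lambda>v. min (lookup d v) m)" by (simp add: t_def)
    moreover have "(\<lambda>v. min (lookup d v) m) \<in> UNIV \<rightarrow>\<^sub>E {..m}" by auto
    ultimately show "d \<in> vec ` (UNIV \<rightarrow>\<^sub>E {..m})" by (rule image_eqI)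
  qed
  moreover have "finite (vec ` ((UNIV :: 'a set) \<rightarrow>\<^sub>E {..m}))"
    by (intro finite_imageI finite_PiE) auto
  ultimately show ?thesis by (rule finite_subset)
qed

lemma cover_sums_subset_covers: "cover_sums E m \<subseteq> covers E m"
proof (induction m)
  case 0
  show ?case by (simp add: covers_def)
next
  case (Suc m)
  then show ?case
    using covers_add[of _ E 1 _ m] by (auto elim!: set_plus_elim)
qed

lemma cover_sums_1: "cover_sums E 1 = covers E 1"
proof -
  have "a + b \<in> covers E 1" if "a \<in> covers E 1" for a b
    using up_closedD[OF up_closed_covers that] by simp
  moreover have "a \<in> covers E 1 + UNIV" if "a \<in> covers E 1" for a
    using set_plus_intro[OF that UNIV_I[of 0]] by simp
  ultimately show ?thesis by (auto elim!: set_plus_elim)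
qed

lemma fold_sum_add:
  fixes U :: "('v \<Rightarrow>\<^sub>0 nat) set"
  assumes U: "up_closed U"
  shows "a \<in> fold_sum U m \<Longrightarrow> b \<in> fold_sum U n \<Longrightarrow> a + b \<in> fold_sum U (m + n)"
proof (induction m arbitrary: a)
  case 0
  then show ?case
    using up_closedD[OF up_closed_fold_sum[OF U]] by simp
next
  case (Suc m)
  obtain u c where "u \<in> U" "c \<in> fold_sum U m" "a = u + c"
    using Suc.prems(1) by (auto elim!: set_plus_elim)
  then show ?case
    using Suc.IH[of c] Suc.prems(2) by (auto simp: add.assoc)
qed

lemma fold_sum_above_minimals:
  assumes "d \<in> fold_sum U m"
  shows "\<exists>ds. set ds \<subseteq> minimals U \<and> length ds = m \<and> sum_list ds \<preceq> d"
  using assms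
proof (induction m arbitrary: d)
  case 0
  show ?case by (simp add: exp_dvd_def)
next
  case (Suc m)
  obtain a b where ab: "a \<in> U" "b \<in> fold_sum U m" "d = a + b"
    using Suc.prems by (auto elim!: set_plus_elim)
  obtain ds where ds: "set ds \<subseteq> minimals U" "length ds = m" "sum_list ds \<preceq> b"
    using Suc.IH[OF ab(2)] by auto
  obtain u where u: "u \<in> minimals U" "u \<preceq> a"
    using ex_minimal_exp_dvd[OF ab(1)] by auto
  show ?case
    using ds u ab(3) exp_dvd_add_mono by (intro exI[of _ "u # ds"]) auto
qed

lemma sum_list_covers: "set ds \<subseteq> covers E 1 \<Longrightarrow> sum_list ds \<in> covers E (length ds)"
proof (induction ds)
  case Nil
  show ?case by (simp add: covers_def)
next
  case (Cons d ds)
  then show ?case using covers_add[of d E 1 "sum_list ds" "length ds"] by simp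
qed

lemma vec_const_covers: "simple_graph E \<Longrightarrow> vec (\<lambda>_. k) \<in> covers E (2 * k)"
  by (simp add: covers_def simple_graph_def)

text \<open>Every edge has two ends, so adding the all-ones vector raises its weight by exactly 2.\<close>

lemma ones_add_covers_iff:
  assumes "simple_graph E"
  shows "ones + d \<in> covers E (m + 2) \<longleftrightarrow> d \<in> covers E m"
proof -
  have "(\<Sum>v\<in>e. lookup (ones + d) v) = 2 + (\<Sum>v\<in>e. lookup d v)" if "e \<in> E" for e
    using assms that by (simp add: simple_graph_def lookup_add sum.distrib del: One_nat_def)
  then show ?thesis by (simp add: covers_def)
qed

text \<open>
  Splitting off a 2-cover: take \<open>2\<close> from the entries that cover all their edges alone and
  \<open>1\<close> from the other positive ones. The neighbours of a vertex of weight \<open>0\<close> have weight at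
  least \<open>m + 2\<close>, so what is taken is a 2-cover. An edge loses more than \<open>2\<close> only at an end of
  weight at least \<open>m + 2\<close>, which keeps weight \<open>m\<close>.
\<close>

lemma covers_split:
  assumes E: "simple_graph E" and d: "d \<in> covers E (m + 2)"
  obtains a b where "a \<in> covers E 2" "b \<in> covers E m" "d = a + b"
proof -
  define f where "f v = (if lookup d v = 0 then 0 else if lookup d v < m + 2 then 1 else (2::nat))" for v
  have "vec f \<preceq> d"
    by (auto simp: exp_dvd_def f_def)
  then have "d = vec f + (d - vec f)"
    by (simp add: exp_dvd_imp_diff_add)
  moreover have "vec f \<in> covers E 2 \<and> d - vec f \<in> covers E m"
  proof -
    have "2 \<le> (\<Sum>v\<in>e. f v) \<and> m \<le> (\<Sum>v\<in>e. lookup d v - f v)" if "e \<in> E" for e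
    proof -
      obtain x y where e: "e = {x, y}" "x \<noteq> y"
        using E \<open>e \<in> E\<close> by (auto simp: simple_graph_def card_2_iff)
      have "m + 2 \<le> (\<Sum>v\<in>e. lookup d v)"
        using d \<open>e \<in> E\<close> by (simp add: covers_def)
      then have "m + 2 \<le> lookup d x + lookup d y"
        using e by simp
      then show ?thesis
        using e by (auto simp: f_def)
    qed
    then show ?thesis by (simp add: covers_def lookup_minus)
  qed
  ultimately show thesis using that by blast
qed

text \<open>
  A vertex on an edge cannot give up its weight 1, as the edge would keep weight at most 1.
  Isolated vertices could, which is why they are excluded.
\<close>

lemma ones_minimal_2_cover:
  assumes E: "simple_graph E" "no_isolated_vertices E"
  shows "ones \<in> minimals (covers E 2)"
proof -
  have "w = ones" if w: "w \<in> covers E 2" "w \<preceq> ones" for w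
  proof (rule poly_mapping_eqI)
    fix v
    obtain e where e: "e \<in> E" "v \<in> e"
      using E(2) by (auto simp: no_isolated_vertices_def)
    then obtain x where x: "e = {v, x}" "v \<noteq> x"
      using E(1) by (fastforce simp: simple_graph_def card_2_iff)
    have "2 \<le> (\<Sum>v\<in>e. lookup w v)"
      using w(1) e by (simp add: covers_def)
    then have "2 \<le> lookup w v + lookup w x"
      using x by simp
    moreover have "lookup w v \<le> 1" "lookup w x \<le> 1"
      using w(2) by (auto simp: exp_dvd_def)
    ultimately show "lookup w v = lookup ones v" by simp
  qed
  then show ?thesis
    using vec_const_covers[OF E(1), of 1] by (auto simp: minimals_def)
qed

section \<open>Covers of graphs with the indecomposability property\<close>

text \<open>
  This is what the hypotheses on \<open>E\<close> amount to in terms of exponents; in particular the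
  coefficient field no longer occurs.
\<close>

locale indecomposable_graph =
  fixes E :: "'v::finite set set"
  assumes graph: "simple_graph E"
    and two_covers: "\<And>d. d \<in> covers E 2 \<Longrightarrow> d \<in> cover_sums E 2 \<or> ones \<preceq> d"
    and indecomposable: "\<And>k ds. k \<ge> 1 \<Longrightarrow> set ds \<subseteq> minimals (covers E 1) \<Longrightarrow>
      vec (\<lambda>_. k) + sum_list ds \<notin> cover_sums E (2 * k + length ds)"
begin

text \<open>
  Split off 2-covers until a 0-cover or a 1-cover remains: either one of them lies above the
  all-ones vector, or all of them are sums of 1-covers. As \<open>F\<close> raises the weight of every edge by
  2, this amounts to \<open>I\<^sup>(\<^sup>m\<^sup>) = I\<^sup>m + F I\<^sup>(\<^sup>m\<^sup>-\<^sup>2\<^sup>)\<close> for \<open>m \<ge> 2\<close>.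
\<close>

lemma covers_cases: "d \<in> covers E m \<Longrightarrow> d \<in> cover_sums E m \<or> ones \<preceq> d"
proof (induction m arbitrary: d rule: less_induct)
  case (less m)
  consider "m = 0" | "m = 1" | n where "m = n + 2"
    by (metis One_nat_def Suc_1 add.commute add_2_eq_Suc not0_implies_Suc)
  then show ?case
  proof cases
    case 1
    then show ?thesis by simp
  next
    case 2
    then show ?thesis using less.prems cover_sums_1 by metis
  next
    case 3
    then obtain a b where ab: "a \<in> covers E 2" "b \<in> covers E n" "d = a + b"
      using covers_split[OF graph] less.prems by blast
    then consider "ones \<preceq> a" | "ones \<preceq> b" | "a \<in> cover_sums E 2" "b \<in> cover_sums E n"
      using two_covers less.IH[of n b] 3 by auto
    then show ?thesis
    proof cases
      case 1
      then show ?thesis using ab(3) exp_dvd_trans[OF _ exp_dvd_add_right] by metis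
    next
      case 2
      then show ?thesis using ab(3) exp_dvd_trans[OF _ exp_dvd_add_left] by metis
    next
      case c: 3
      have "a + b \<in> cover_sums E (2 + n)"
        using c by (rule fold_sum_add[OF up_closed_covers])
      then show ?thesis using ab(3) 3 by (simp add: add.commute)
    qed
  qed
qed

text \<open>
  So \<open>I\<^sup>(\<^sup>m\<^sup>)\<close> is generated by the products \<open>F\<^sup>k g\<^sub>1 \<dots> g\<^sub>s\<close> with \<open>2k + s = m\<close>, where the \<open>g\<^sub>i\<close> are
  minimal generators of \<open>I\<close>. These are the products that indecomposability speaks about.
\<close>

lemma covers_above_product:
  "d \<in> covers E m \<Longrightarrow>
    \<exists>k ds. set ds \<subseteq> minimals (covers E 1) \<and> 2 * k + length ds = m \<and> vec (\<lambda>_. k) + sum_list ds \<preceq> d"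
proof (induction m arbitrary: d rule: less_induct)
  case (less m)
  show ?case
  proof (cases "d \<in> cover_sums E m")
    case True
    then obtain ds where "set ds \<subseteq> minimals (covers E 1)" "length ds = m" "sum_list ds \<preceq> d"
      using fold_sum_above_minimals by blast
    then show ?thesis
      by (intro exI[of _ 0] exI[of _ ds]) (simp add: vec_0)
  next
    case False
    then have "m \<noteq> 0" "m \<noteq> 1"
      using less.prems cover_sums_1[of E] by (auto intro: ccontr)
    then obtain n where m: "m = n + 2"
      by (metis One_nat_def Suc_1 add.commute add_2_eq_Suc not0_implies_Suc)
    obtain d' where d': "d = ones + d'"
      using covers_cases[OF less.prems] False exp_dvd_imp_diff_add by metis
    then have "d' \<in> covers E n"
      using less.prems m ones_add_covers_iff[OF graph] by simp
    then obtain k ds where "set ds \<subseteq> minimals (covers E 1)" "2 * k + length ds = n"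
      "vec (\<lambda>_. k) + sum_list ds \<preceq> d'"
      using less.IH[of n d'] m by auto
    moreover have "vec (\<lambda>_. Suc k) + sum_list ds = ones + (vec (\<lambda>_. k) + sum_list ds)"
      by (simp add: vec_add flip: add.assoc)
    ultimately show ?thesis
      unfolding d' m by (intro exI[of _ "Suc k"] exI[of _ ds]) simp
  qed
qed

text \<open>
  A minimal generator of \<open>I\<^sup>(\<^sup>m\<^sup>)\<close> equals a product \<open>F\<^sup>k g\<^sub>1 \<dots> g\<^sub>s\<close> that divides it. One more factor
  \<open>F\<close> makes the exponent of \<open>F\<close> positive, so that indecomposability applies even if \<open>k = 0\<close>.
\<close>

lemma ones_add_minimal_notin_cover_sums:
  assumes u: "u \<in> minimals (covers E m)"
  shows "ones + u \<notin> cover_sums E (m + 2)"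
proof -
  obtain k ds where ds: "set ds \<subseteq> minimals (covers E 1)" "2 * k + length ds = m"
    "vec (\<lambda>_. k) + sum_list ds \<preceq> u"
    using covers_above_product u minimals_subset by blast
  have "set ds \<subseteq> covers E 1"
    using ds(1) minimals_subset by (rule order_trans)
  then have "vec (\<lambda>_. k) + sum_list ds \<in> covers E (2 * k + length ds)"
    using vec_const_covers[OF graph] sum_list_covers covers_add by blast
  then have "vec (\<lambda>_. k) + sum_list ds = u"
    using minimalsD[OF u] ds by simp
  then have "ones + u = vec (\<lambda>_. Suc k) + sum_list ds"
    by (auto simp: vec_add simp flip: add.assoc)
  moreover have "2 * Suc k + length ds = m + 2"
    using ds(2) by simp
  ultimately show ?thesis
    using indecomposable[of "Suc k" ds] ds(1) by simp
qed

text \<open>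
  Covers outside the sums are multiples of \<open>F\<close>. Conversely, if \<open>u\<close> is minimal, then \<open>F u\<close> is not
  in \<open>I\<^sup>m\<^sup>+\<^sup>2\<close>, hence neither is any divisor of it; so divisors of \<open>F u\<close> in \<open>I\<^sup>(\<^sup>m\<^sup>+\<^sup>2\<^sup>)\<close> are
  themselves \<open>F\<close> times a divisor of \<open>u\<close>.
\<close>

lemma minimal_covers_not_sums:
  "minimals (covers E (m + 2)) - cover_sums E (m + 2) = (+) ones ` minimals (covers E m)"
proof (intro equalityI subsetI)
  fix d assume d: "d \<in> minimals (covers E (m + 2)) - cover_sums E (m + 2)"
  then have dc: "d \<in> covers E (m + 2)" using minimals_subset by blast
  then obtain u where u: "d = ones + u"
    using covers_cases d exp_dvd_imp_diff_add by (metis DiffD2)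
  have "u \<in> minimals (covers E m)"
    unfolding minimals_def
  proof (intro CollectI conjI ballI impI)
    show "u \<in> covers E m"
      using dc u ones_add_covers_iff[OF graph] by simp
    fix w assume "w \<in> covers E m" "w \<preceq> u"
    then have "ones + w \<in> covers E (m + 2)" "ones + w \<preceq> d"
      using u ones_add_covers_iff[OF graph] by auto
    then have "ones + w = d" using d minimalsD by blast
    then show "w = u" using u by simp
  qed
  then show "d \<in> (+) ones ` minimals (covers E m)" using u by simp
next
  fix d assume "d \<in> (+) ones ` minimals (covers E m)"
  then obtain u where u: "u \<in> minimals (covers E m)" "d = ones + u" by auto
  have notin: "d \<notin> cover_sums E (m + 2)"
    using ones_add_minimal_notin_cover_sums u by simp
  have "d \<in> minimals (covers E (m + 2))"
    unfolding minimals_def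
  proof (intro CollectI conjI ballI impI)
    show "d \<in> covers E (m + 2)"
      using u ones_add_covers_iff[OF graph] minimals_subset by blast
    fix w assume w: "w \<in> covers E (m + 2)" "w \<preceq> d"
    then have "w \<notin> cover_sums E (m + 2)"
      using notin up_closedD[OF up_closed_fold_sum[OF up_closed_covers]] by blast
    then obtain w' where w': "w = ones + w'"
      using covers_cases[OF w(1)] exp_dvd_imp_diff_add by metis
    then have "w' \<in> covers E m" "w' \<preceq> u"
      using w u ones_add_covers_iff[OF graph] by auto
    then show "w = d" using minimalsD[OF u(1)] w' u(2) by simp
  qed
  then show "d \<in> minimals (covers E (m + 2)) - cover_sums E (m + 2)"
    using notin by simp
qed

text \<open>
  If \<open>F\<close> divides a minimal \<open>m\<close>-cover with \<open>m \<ge> 2\<close>, then the cofactor is a minimal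
  \<open>(m-2)\<close>-cover and the cover is not in \<open>I\<^sup>m\<close> by indecomposability. A 1-cover divisible by \<open>F\<close>
  stays one when a single exponent is lowered, because every edge has a second end. Conversely, a divisor in \<open>I\<^sup>(\<^sup>m\<^sup>)\<close> of a monomial that \<open>F\<close>
  does not divide is in \<open>I\<^sup>m\<close>.
\<close>

lemma minimal_covers_in_sums:
  assumes "m \<ge> 1"
  shows "minimals (covers E m) \<inter> cover_sums E m = {u \<in> minimals (cover_sums E m). \<not> ones \<preceq> u}"
proof (intro equalityI subsetI)
  fix u assume u: "u \<in> minimals (covers E m) \<inter> cover_sums E m"
  then have "u \<in> minimals (cover_sums E m)"
    using cover_sums_subset_covers by (auto simp: minimals_def)
  moreover have "\<not> ones \<preceq> u"
  proof
    assume "ones \<preceq> u"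
    then have u1: "u = ones + (u - ones)" by (simp add: exp_dvd_imp_diff_add)
    show False
    proof (cases "m = 1")
      case True
      \<comment> \<open>Some vertex exists, as types are not empty; its exponent can be lowered.\<close>
      fix v :: 'v
      define w where "w = u - single v 1"
      have pos: "1 \<le> lookup u x" for x
        using \<open>ones \<preceq> u\<close> by (auto simp: exp_dvd_def)
      have "1 \<le> (\<Sum>x\<in>e. lookup w x)" if "e \<in> E" for e
      proof -
        have "\<not> e \<subseteq> {v}"
          using graph that card_mono[of "{v}" e] by (auto simp: simple_graph_def)
        then obtain x where "x \<in> e" "x \<noteq> v" by blast
        then have "1 \<le> lookup w x"
          using pos[of x] by (simp add: w_def lookup_minus lookup_single when_def)
        then show ?thesis
          using member_le_sum[of x e "lookup w"] \<open>x \<in> e\<close> by simp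
      qed
      then have "w \<in> covers E m"
        using True by (simp add: covers_def)
      moreover have "w \<preceq> u"
        by (simp add: w_def exp_dvd_def lookup_minus)
      ultimately have "w = u" using u minimalsD by blast
      then have "lookup u v - 1 = lookup u v"
        by (metis lookup_minus lookup_single_eq w_def)
      then show False using pos[of v] by simp
    next
      case False
      then obtain n where m: "m = n + 2"
        using assms by (metis One_nat_def Suc_1 add.commute add_2_eq_Suc not0_implies_Suc not_one_le_zero)
      have "u - ones \<in> minimals (covers E n)"
        unfolding minimals_def
      proof (intro CollectI conjI ballI impI)
        show "u - ones \<in> covers E n"
          using u u1 m ones_add_covers_iff[OF graph] minimals_subset by (metis IntD1 subsetD)
        fix w assume "w \<in> covers E n" "w \<preceq> u - ones"
        then have "ones + w \<in> covers E m" "ones + w \<preceq> ones + (u - ones)"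
          using m ones_add_covers_iff[OF graph] by auto
        then have "ones + w = u" using u minimalsD u1 by (metis IntD1)
        then show "w = u - ones" using u1 by (metis add_left_cancel)
      qed
      then show False
        using ones_add_minimal_notin_cover_sums u u1 m by (metis IntD2)
    qed
  qed
  ultimately show "u \<in> {u \<in> minimals (cover_sums E m). \<not> ones \<preceq> u}" by simp
next
  fix u assume u: "u \<in> {u \<in> minimals (cover_sums E m). \<not> ones \<preceq> u}"
  then have us: "u \<in> cover_sums E m" using minimals_subset by blast
  have "w = u" if "w \<in> covers E m" "w \<preceq> u" for w
  proof -
    have "w \<in> cover_sums E m"
      using covers_cases[OF that(1)] exp_dvd_trans[OF _ that(2)] u by blast
    then show ?thesis using u that(2) minimalsD by blast
  qed
  then show "u \<in> minimals (covers E m) \<inter> cover_sums E m"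
    using us cover_sums_subset_covers by (auto simp: minimals_def)
qed

end

section \<open>Symbolic defects\<close>

lemma sdefect_eq_card:
  "sdefect TYPE('k::field) E m = enat (card (minimals (covers E m) - cover_sums E m))"
  unfolding sdefect_def cover_symbolic_power_eq ideal_pow_cover_ideal_eq
  by (intro num_gens_quotient_monomial_ideals up_closed_covers up_closed_fold_sum
      finite_Diff finite_minimals_covers)

lemma nu_eq_card:
  "nu (cover_ideal E :: ('v::finite, 'k::field) mpoly set) m =
    card {u \<in> minimals (cover_sums E m). \<not> ones \<preceq> u}"
proof -
  have "{g \<in> min_monom_gens (ideal_pow (cover_ideal E) m). \<not> prod_vars dvd g} =
      (monom ` {u \<in> minimals (cover_sums E m). \<not> ones \<preceq> u} :: ('v, 'k) mpoly set)"
    by (auto simp: ideal_pow_cover_ideal_eq min_monom_gens_monomial_ideal up_closed_fold_sum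
        up_closed_covers prod_vars_eq monom_dvd_iff)
  then show ?thesis
    by (simp add: nu_def card_image inj_on_def)
qed

text \<open>
  The all-ones vector is a minimal 2-cover, and indecomposability for \<open>k = 1\<close> and no further
  factors says that it is no sum of two 1-covers. As the second symbolic defect counts such
  covers, it is the only one.
\<close>

lemma indecomposable_graphI:
  assumes E: "simple_graph E" "no_isolated_vertices E"
    and sdef: "sdefect TYPE('k::field) E 2 = 1"
    and ind: "indecomposability_property TYPE('k) E"
  shows "indecomposable_graph E"
proof
  show "simple_graph E" by (rule E)
  show indec: "vec (\<lambda>_. k) + sum_list ds \<notin> cover_sums E (2 * k + length ds)"
    if "k \<ge> 1" "set ds \<subseteq> minimals (covers E 1)" for k ds
  proof -
    have "set (map monom ds) \<subseteq> min_monom_gens (cover_ideal E :: ('a, 'k) mpoly set)"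
      using that(2) by (auto simp: cover_ideal_eq min_monom_gens_monomial_ideal up_closed_covers)
    then have "prod_vars ^ k * prod_list (map monom ds) \<notin>
        ideal_pow (cover_ideal E :: ('a, 'k) mpoly set) (2 * k + length (map monom ds :: ('a, 'k) mpoly list))"
      using ind that(1) unfolding indecomposability_property_def by blast
    then show ?thesis
      by (simp add: prod_vars_eq monom_power prod_list_monom monom_mult ideal_pow_cover_ideal_eq
          del: One_nat_def)
  qed
  fix d assume "d \<in> covers E 2"
  then obtain w where w: "w \<in> minimals (covers E 2)" "w \<preceq> d"
    using ex_minimal_exp_dvd by blast
  have "ones \<notin> cover_sums E 2"
    using indec[of 1 "[]"] by simp
  then have "ones \<in> minimals (covers E 2) - cover_sums E 2"
    using ones_minimal_2_cover[OF E] by simp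
  moreover have "card (minimals (covers E 2) - cover_sums E 2) = 1"
    using sdef unfolding sdefect_eq_card by (simp add: one_enat_def)
  ultimately have "minimals (covers E 2) - cover_sums E 2 = {ones}"
    by (metis card_1_singletonE singletonD)
  then have "w \<in> cover_sums E 2 \<or> w = ones"
    using w(1) by blast
  then show "d \<in> cover_sums E 2 \<or> ones \<preceq> d"
    using w(2) up_closedD[OF up_closed_fold_sum[OF up_closed_covers]] by blast
qed

theorem theorem5p5:
  fixes E :: "'v::finite set set"
    and I :: "('v, 'k::field) mpoly set"
    and m :: nat
  assumes "simple_graph E"
    and "no_isolated_vertices E"
    and "I = cover_ideal E"
    and "sdefect TYPE('k) E 2 = 1"
    and "indecomposability_property TYPE('k) E"
    and "m \<ge> 3"
  shows "sdefect TYPE('k) E m = sdefect TYPE('k) E (m - 2) + enat (nu I (m - 2))"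
proof -
  interpret indecomposable_graph E
    using indecomposable_graphI assms by blast
  define n where "n = m - 2"
  have n: "n \<ge> 1" "m = n + 2" using assms(6) by (auto simp: n_def)
  let ?M = "minimals (covers E n)" and ?P = "cover_sums E n"
  have "card (minimals (covers E m) - cover_sums E m) = card ?M"
    unfolding n minimal_covers_not_sums by (simp add: card_image)
  also have "\<dots> = card (?M - ?P) + card (?M \<inter> ?P)"
    using card_Int_Diff[OF finite_minimals_covers] by (simp add: add.commute)
  also have "card (?M \<inter> ?P) = nu I n"
    by (simp only: minimal_covers_in_sums n(1) assms(3) nu_eq_card)
  finally show ?thesis
    by (simp add: sdefect_eq_card n_def)
qed

end
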